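(* Let $\mathcal{C}$ be a clone on a finite nonempty set $C$, and let $n \ge |C|$ be an integer. Then $\mathcal{C}$ is finitely related if and only if its action algebra $\widetilde{\mathcal{C}} = \mathcal{C} \curvearrowright \mathcal{C}^{(n)}$ is finitely related.
   Context: All operations have finite arity at least $1$, and all relations have finite arity. A clone on a set $A$ is a set of finitary operations on $A$ that contains every projection $\pi_i^n(x_1,\dots,x_n)=x_i$ ($1\le i\le n$) and is closed under composition: if $f$ is an $m$-ary member and $g_1,\dots,g_m$ are $n$-ary members, then $f(g_1,\dots,g_m)$, the operation $x\mapsto f(g_1(x),\dots,g_m(x))$ on $A^n$, is a member. A $k$-ary operation $f$ on $A$ preserves a relation $R\subseteq A^r$ if for all $r^1,\dots,r^k\in R$ the tuple $f(r^1,\dots,r^k)$, computed coordinatewise, is in $R$. $\mathrm{Pol}(R_1,\dots,R_k)$ is the set of all operations on $A$ preserving every $R_i$. A clone on $A$ is finitely related if it equals $\mathrm{Pol}(R_1,\dots,R_k)$ for finitely many relations $R_1,\dots,R_k$ on $A$. For a clone $\mathcal{C}$ on $C$, $\mathcal{C}^{(n)}$ denotes the set of $n$-ary operations in $\mathcal{C}$. Each $k$-ary $f\in\mathcal{C}$ induces a $k$-ary operation $\tilde f$ on the set $\mathcal{C}^{(n)}$ by $\tilde f(g_1,\dots,g_k)=f(g_1,\dots,g_k)$ (composition), i.e. $\tilde f(g_1,\dots,g_k)(a)=f(g_1(a),\dots,g_k(a))$ for $a\in C^n$. The action algebra $\widetilde{\mathcal{C}}=\mathcal{C}\curvearrowright\mathcal{C}^{(n)}$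 is the algebra with universe $\mathcal{C}^{(n)}$ and operations $\{\tilde f : f\in\mathcal{C}\}$. This set of operations is a clone on the set $\mathcal{C}^{(n)}$; the action algebra is called finitely related if this clone is finitely related, the relations being on the set $\mathcal{C}^{(n)}$. *)

theory Defs
  imports "HOL-Library.FuncSet"
begin

definition tuples :: "'a set \<Rightarrow> nat \<Rightarrow> 'a list set" where
  "tuples A k = {xs. length xs = k \<and> set xs \<subseteq> A}"

text \<open>
  Operations and relations carry their arity, since it cannot be recovered from the bare function
  (when \<open>A = {undefined}\<close>) or from the bare set of tuples (when it is empty).
  Operations are extensional, so that equality of operations on \<open>A\<close> is HOL equality.
\<close>

type_synonym 'a oper = "nat \<times> ('a list \<Rightarrow> 'a)"
type_synonym 'a relat = "nat \<times> 'a list set"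

definition operations :: "'a set \<Rightarrow> 'a oper set" where
  "operations A = {(k, f). 1 \<le> k \<and> f \<in> tuples A k \<rightarrow>\<^sub>E A}"

definition relations :: "'a set \<Rightarrow> 'a relat set" where
  "relations A = {(r, R). R \<subseteq> tuples A r}"

definition nary_part :: "'a oper set \<Rightarrow> nat \<Rightarrow> ('a list \<Rightarrow> 'a) set" where
  "nary_part F n = {f. (n, f) \<in> F}"

text \<open>Projections are indexed from \<open>0\<close>.\<close>

definition projection :: "'a set \<Rightarrow> nat \<Rightarrow> nat \<Rightarrow> 'a list \<Rightarrow> 'a" where
  "projection A n i = (\<lambda>x\<in>tuples A n. x ! i)"

definition compose_op ::
    "'a set \<Rightarrow> nat \<Rightarrow> ('a list \<Rightarrow> 'a) \<Rightarrow> ('a list \<Rightarrow> 'a) list \<Rightarrow> 'a list \<Rightarrow> 'a" where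
  "compose_op A n f gs = (\<lambda>x\<in>tuples A n. f (map (\<lambda>g. g x) gs))"

definition is_clone :: "'a set \<Rightarrow> 'a oper set \<Rightarrow> bool" where
  "is_clone A F \<longleftrightarrow>
     F \<subseteq> operations A \<and>
     (\<forall>n i. i < n \<longrightarrow> (n, projection A n i) \<in> F) \<and>
     (\<forall>m n f gs. (m, f) \<in> F \<longrightarrow> gs \<in> tuples (nary_part F n) m \<longrightarrow>
        (n, compose_op A n f gs) \<in> F)"

definition preserves :: "'a oper \<Rightarrow> 'a relat \<Rightarrow> bool" where
  "preserves = (\<lambda>(k, f) (r, R).
     \<forall>ts \<in> tuples R k. map (\<lambda>i. f (map (\<lambda>t. t ! i) ts)) [0..<r] \<in> R)"

definition Pol :: "'a set \<Rightarrow> 'a relat set \<Rightarrow> 'a oper set" where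
  "Pol A \<R> = {p \<in> operations A. \<forall>\<rho>\<in>\<R>. preserves p \<rho>}"

definition finitely_related :: "'a set \<Rightarrow> 'a oper set \<Rightarrow> bool" where
  "finitely_related A F \<longleftrightarrow> (\<exists>\<R>. finite \<R> \<and> \<R> \<subseteq> relations A \<and> F = Pol A \<R>)"

definition action_op ::
    "'a set \<Rightarrow> 'a oper set \<Rightarrow> nat \<Rightarrow> nat \<Rightarrow> ('a list \<Rightarrow> 'a) \<Rightarrow> ('a list \<Rightarrow> 'a) list \<Rightarrow> ('a list \<Rightarrow> 'a)"
  where "action_op A F n k f = (\<lambda>gs\<in>tuples (nary_part F n) k. compose_op A n f gs)"

text \<open>The operations of the action algebra, whose universe is \<^term>\<open>nary_part F n\<close>.\<close>

definition action_ops :: "'a set \<Rightarrow> 'a oper set \<Rightarrow> nat \<Rightarrow> ('a list \<Rightarrow> 'a) oper set" where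
  "action_ops A F n = {(k, action_op A F n k f) | k f. (k, f) \<in> F}"

lemma is_clone_action_ops:
  assumes "is_clone A F"
  shows "is_clone (nary_part F n) (action_ops A F n)"
proof -
  let ?U = "nary_part F n"
  have ops: "F \<subseteq> operations A"
    and proj: "\<And>n i. i < n \<Longrightarrow> (n, projection A n i) \<in> F"
    and comp: "\<And>m n f gs. (m, f) \<in> F \<Longrightarrow> gs \<in> tuples (nary_part F n) m \<Longrightarrow>
        (n, compose_op A n f gs) \<in> F"
    using assms by (auto simp: is_clone_def)
  have U: "h \<in> tuples A n \<rightarrow>\<^sub>E A" if "h \<in> ?U" for h
    using that ops by (auto simp: nary_part_def operations_def)
  have ev: "map (\<lambda>h. h x) hs \<in> tuples A k" if "hs \<in> tuples ?U k" "x \<in> tuples A n" for hs x k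
  proof -
    have "h x \<in> A" if "h \<in> set hs" for h
    proof -
      have "h \<in> ?U" using \<open>hs \<in> tuples ?U k\<close> that by (auto simp: tuples_def)
      then show ?thesis using U \<open>x \<in> tuples A n\<close> by (blast intro: PiE_mem)
    qed
    then show ?thesis using that by (auto simp: tuples_def)
  qed
  have sub: "action_ops A F n \<subseteq> operations ?U"
  proof
    fix p assume "p \<in> action_ops A F n"
    then obtain k f where p: "p = (k, action_op A F n k f)" and f: "(k, f) \<in> F"
      by (auto simp: action_ops_def)
    have "1 \<le> k" using f ops by (auto simp: operations_def)
    moreover have "action_op A F n k f \<in> tuples ?U k \<rightarrow>\<^sub>E ?U"
      unfolding action_op_def using comp[OF f] by (simp add: nary_part_def)
    ultimately show "p \<in> operations ?U" by (simp add: p operations_def)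
  qed
  have pr: "(m, projection ?U m i) \<in> action_ops A F n" if "i < m" for m i
  proof -
    have "projection ?U m i = action_op A F n m (projection A m i)"
      unfolding action_op_def
    proof (subst projection_def, rule restrict_ext)
      fix hs assume hs: "hs \<in> tuples ?U m"
      then have len: "length hs = m" and "hs ! i \<in> ?U"
        using that by (auto simp: tuples_def)
      then have "hs ! i = restrict (hs ! i) (tuples A n)"
        using U PiE_restrict by metis
      also have "\<dots> = compose_op A n (projection A m i) hs"
        unfolding compose_op_def
        by (rule restrict_ext) (use ev[OF hs] that len in \<open>simp add: projection_def\<close>)
      finally show "hs ! i = compose_op A n (projection A m i) hs" .
    qed
    then show ?thesis using proj[OF that] by (auto simp: action_ops_def)
  qed
  have cl: "(m, compose_op ?U m f gs) \<in> action_ops A F n"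
    if f: "(k, f) \<in> action_ops A F n" and gs: "gs \<in> tuples (nary_part (action_ops A F n) m) k"
    for k m f gs
  proof -
    obtain f' where f': "(k, f') \<in> F" "f = action_op A F n k f'"
      using f by (auto simp: action_ops_def)
    have "\<forall>g\<in>set gs. \<exists>g'. (m, g') \<in> F \<and> g = action_op A F n m g'"
      using gs by (auto simp: tuples_def nary_part_def action_ops_def)
    then obtain c where c: "\<And>g. g \<in> set gs \<Longrightarrow> (m, c g) \<in> F \<and> g = action_op A F n m (c g)"
      by metis
    have cF: "(m, c g) \<in> F" if "g \<in> set gs" for g
      using c that by blast
    have len: "length gs = k" using gs by (simp add: tuples_def)
    have "compose_op ?U m f gs = action_op A F n m (compose_op A m f' (map c gs))"
      unfolding action_op_def
    proof (subst compose_op_def, rule restrict_ext)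
      fix hs assume hs: "hs \<in> tuples ?U m"
      have eq: "map (\<lambda>g. g hs) gs = map (\<lambda>g. compose_op A n (c g) hs) gs"
      proof (rule map_cong[OF refl])
        fix g assume "g \<in> set gs"
        then have "g hs = action_op A F n m (c g) hs" using c by metis
        then show "g hs = compose_op A n (c g) hs" using hs by (simp add: action_op_def)
      qed
      have mem: "map (\<lambda>g. compose_op A n (c g) hs) gs \<in> tuples ?U k"
        using cF comp hs len by (auto simp: tuples_def nary_part_def)
      show "f (map (\<lambda>g. g hs) gs) = compose_op A n (compose_op A m f' (map c gs)) hs"
        unfolding eq f'(2) action_op_def restrict_apply'[OF mem]
        unfolding compose_op_def
        by (rule restrict_ext) (use ev[OF hs] in \<open>simp add: comp_def\<close>)
    qed
    moreover have "(m, compose_op A m f' (map c gs)) \<in> F"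
      by (rule comp[OF f'(1)]) (use cF len in \<open>auto simp: tuples_def nary_part_def\<close>)
    ultimately show ?thesis by (auto simp: action_ops_def)
  qed
  show ?thesis unfolding is_clone_def by (intro conjI allI impI sub pr cl)
qed

end

theory Submission
  imports Defs
begin

text \<open>
  Identifying variables of an operation \<open>f\<close> gives its minors
  \<open>(x\<^sub>1, \<dots>, x\<^sub>k) \<mapsto> f (x\<^bsub>\<sigma> 1\<^esub>, \<dots>, x\<^bsub>\<sigma> m\<^esub>)\<close>. On a finite set a clone is finitely related iff, for
  some \<open>k \<ge> 1\<close>, an operation belongs to the clone as soon as all its \<open>k\<close>-ary minors do
  (\<open>finitely_related_iff_determined_by_minors\<close>): if every defining relation has at most \<open>k\<close> elements,
  then any list of its elements repeats at most \<open>k\<close> of them, so preservation by \<open>f\<close> is a matter of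
  the \<open>k\<close>-ary minors of \<open>f\<close>; conversely, a single relation, consisting of the value tables of the
  \<open>k\<close>-ary members of the clone, forces the \<open>k\<close>-ary minors of its polymorphisms into the clone.
  The property persists when \<open>k\<close> grows, so it may be tested at one large \<open>k\<close> for both clones.

  Let \<open>U\<close> be the \<open>n\<close>-ary part of the clone. Since \<open>n \<ge> card C\<close>, some \<open>a \<in> C\<^sup>n\<close> lists all of \<open>C\<close>, and
  evaluating the projections at \<open>a\<close> yields every element of \<open>C\<close>. Hence an operation on \<open>C\<close> is
  determined by its action on \<open>U\<close> (\<open>action_op_inject\<close>). Taking minors commutes with
  acting on \<open>U\<close> (\<open>minor_action_op\<close>), so it remains to pass between operations on \<open>C\<close> and on \<open>U\<close>
  when only their minors are known to belong to the clones. For \<open>k \<ge> card U\<close>, an operation on \<open>C\<close>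
  with \<open>k\<close>-ary minors in the clone maps tuples over \<open>U\<close> into \<open>U\<close>, since such a tuple has
  at most \<open>k\<close> different entries. For \<open>k \<ge> (card U)\<^sup>2\<close>, an operation on \<open>U\<close> with \<open>k\<close>-ary minors in the action
  clone is the action of some operation on \<open>C\<close> (\<open>action_op_of_minors\<close>): its value at a point depends
  only on the values of its arguments there, because a comparison of two argument tuples involves
  at most \<open>(card U)\<^sup>2\<close> different pairs of entries, so it can be made in a minor.
\<close>

section \<open>Tuples over small sets\<close>

lemma ex_enumerating_tuple:
  assumes "finite S" "S \<noteq> {}" "card S \<le> k"
  shows "\<exists>xs\<in>tuples S k. set xs = S"
proof -
  obtain ys where ys: "set ys = S" "distinct ys"
    using finite_distinct_list[OF assms(1)] by blast
  then have len: "length ys \<le> k" using assms(3) distinct_card by fastforce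
  obtain s where "s \<in> S" using assms(2) by blast
  then have "set (ys @ replicate (k - length ys) s) = S"
    using ys by (auto simp: set_replicate_conv_if)
  then show ?thesis
    using len by (intro bexI[of _ "ys @ replicate (k - length ys) s"]) (auto simp: tuples_def)
qed

text \<open>The form in which finiteness enters: a tuple of any length over a set with at most \<open>k\<close> elements
  is a substitution instance of a \<open>k\<close>-tuple.\<close>

lemma tuple_through_index:
  assumes "finite S" "card S \<le> k" "xs \<in> tuples S m" "1 \<le> m"
  obtains ys \<sigma> where "ys \<in> tuples S k" "\<sigma> \<in> tuples {..<k} m" "xs = map ((!) ys) \<sigma>"
proof -
  have "S \<noteq> {}" using assms(3,4) by (auto simp: tuples_def)
  then obtain ys where ys: "ys \<in> tuples S k" "set ys = S"
    using ex_enumerating_tuple assms(1,2) by metis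
  then have "\<forall>s\<in>S. \<exists>i<k. ys ! i = s" by (auto simp: tuples_def in_set_conv_nth)
  then obtain idx where idx: "\<And>s. s \<in> S \<Longrightarrow> idx s < k \<and> ys ! idx s = s" by metis
  have "map idx xs \<in> tuples {..<k} m" using assms(3) idx by (auto simp: tuples_def)
  moreover have "xs = map ((!) ys) (map idx xs)"
    using assms(3) idx by (auto simp: tuples_def intro!: map_idI[symmetric])
  ultimately show thesis using ys(1) that by blast
qed

lemma map_nth_in_tuples:
  assumes "xs \<in> tuples A k" "\<sigma> \<in> tuples {..<k} m"
  shows "map ((!) xs) \<sigma> \<in> tuples A m"
  using assms by (force simp: tuples_def)

lemma map_in_tuples:
  assumes "xs \<in> tuples A k" "\<And>x. x \<in> A \<Longrightarrow> f x \<in> B"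
  shows "map f xs \<in> tuples B k"
  using assms by (auto simp: tuples_def)

lemma map_nth_map:
  assumes "xs \<in> tuples A k" "\<sigma> \<in> tuples {..<k} m"
  shows "map ((!) (map f xs)) \<sigma> = map f (map ((!) xs) \<sigma>)"
  using assms by (auto simp: tuples_def)

lemma finite_tuples: "finite A \<Longrightarrow> finite (tuples A k)"
  using finite_lists_length_eq[of A k] by (simp add: tuples_def conj_commute)

section \<open>Minors of operations\<close>

definition minor :: "'a set \<Rightarrow> nat \<Rightarrow> ('a list \<Rightarrow> 'a) \<Rightarrow> nat list \<Rightarrow> 'a list \<Rightarrow> 'a" where
  "minor A k f \<sigma> = compose_op A k f (map (projection A k) \<sigma>)"

lemma minor_apply:
  assumes "x \<in> tuples A k"
  shows "minor A k f \<sigma> x = f (map ((!) x) \<sigma>)"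
  using assms by (simp add: minor_def compose_op_def projection_def comp_def)

lemma minor_extensional: "minor A k f \<sigma> \<in> extensional (tuples A k)"
  by (simp add: minor_def compose_op_def)

lemma minor_PiE:
  assumes "f \<in> tuples A m \<rightarrow>\<^sub>E A" "\<sigma> \<in> tuples {..<k} m"
  shows "minor A k f \<sigma> \<in> tuples A k \<rightarrow>\<^sub>E A"
proof (rule PiE_I)
  show "minor A k f \<sigma> x \<in> A" if "x \<in> tuples A k" for x
    unfolding minor_apply[OF that] using map_nth_in_tuples[OF that assms(2)] assms(1) by blast
qed (rule extensional_arb[OF minor_extensional])

lemma clone_operations: "is_clone A F \<Longrightarrow> (m, f) \<in> F \<Longrightarrow> 1 \<le> m \<and> f \<in> tuples A m \<rightarrow>\<^sub>E A"
  by (auto simp: is_clone_def operations_def)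

lemma clone_projection: "is_clone A F \<Longrightarrow> i < n \<Longrightarrow> projection A n i \<in> nary_part F n"
  by (simp add: is_clone_def nary_part_def)

lemma clone_compose:
  "is_clone A F \<Longrightarrow> (m, f) \<in> F \<Longrightarrow> gs \<in> tuples (nary_part F n) m \<Longrightarrow> (n, compose_op A n f gs) \<in> F"
  by (simp add: is_clone_def)

lemma projections_in_tuples:
  assumes "is_clone A F" "\<sigma> \<in> tuples {..<k} m"
  shows "map (projection A k) \<sigma> \<in> tuples (nary_part F k) m"
  using map_in_tuples[OF assms(2)] clone_projection[OF assms(1)] by (metis lessThan_iff)

lemma minor_in_clone:
  assumes "is_clone A F" "(m, f) \<in> F" "\<sigma> \<in> tuples {..<k} m"
  shows "(k, minor A k f \<sigma>) \<in> F"
  unfolding minor_def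
  by (rule clone_compose[OF assms(1,2) projections_in_tuples[OF assms(1,3)]])

definition determined_by_minors :: "'a set \<Rightarrow> 'a oper set \<Rightarrow> nat \<Rightarrow> bool" where
  "determined_by_minors A F k \<longleftrightarrow>
     (\<forall>m f. (m, f) \<in> operations A \<longrightarrow> (\<forall>\<sigma>\<in>tuples {..<k} m. (k, minor A k f \<sigma>) \<in> F) \<longrightarrow> (m, f) \<in> F)"

lemma determined_by_minorsD:
  assumes "determined_by_minors A F k" "(m, f) \<in> operations A"
    and "\<And>\<sigma>. \<sigma> \<in> tuples {..<k} m \<Longrightarrow> (k, minor A k f \<sigma>) \<in> F"
  shows "(m, f) \<in> F"
  using assms by (auto simp: determined_by_minors_def)

lemma determined_by_minors_mono:
  assumes clone: "is_clone A F" and det: "determined_by_minors A F k" and k: "1 \<le> k" "k \<le> K"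
  shows "determined_by_minors A F K"
  unfolding determined_by_minors_def
proof (intro allI impI)
  fix m f assume op: "(m, f) \<in> operations A"
    and minors: "\<forall>\<sigma>\<in>tuples {..<K} m. (K, minor A K f \<sigma>) \<in> F"
  show "(m, f) \<in> F"
  proof (rule determined_by_minorsD[OF det op])
    fix \<sigma> assume \<sigma>: "\<sigma> \<in> tuples {..<k} m"
    \<comment> \<open>Any retraction of the indices below \<open>K\<close> onto those below \<open>k\<close> turns the \<open>K\<close>-ary minor given by
      \<open>\<sigma>\<close> into the \<open>k\<close>-ary one.\<close>
    define \<tau> where "\<tau> = map (\<lambda>i. min i (k - 1)) [0..<K]"
    have \<tau>: "\<tau> \<in> tuples {..<k} K" using k by (auto simp: \<tau>_def tuples_def)
    have \<sigma>K: "\<sigma> \<in> tuples {..<K} m" using \<sigma> k by (force simp: tuples_def)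
    have "minor A k f \<sigma> = minor A k (minor A K f \<sigma>) \<tau>"
    proof (rule extensionalityI[OF minor_extensional minor_extensional])
      fix x assume x: "x \<in> tuples A k"
      have "map ((!) (map ((!) x) \<tau>)) \<sigma> = map ((!) x) \<sigma>"
      proof (rule map_cong[OF refl])
        fix i assume "i \<in> set \<sigma>"
        then have "i < k" using \<sigma> by (auto simp: tuples_def)
        then show "map ((!) x) \<tau> ! i = x ! i" using k by (simp add: \<tau>_def)
      qed
      then show "minor A k f \<sigma> x = minor A k (minor A K f \<sigma>) \<tau> x"
        by (simp only: minor_apply[OF x] minor_apply[OF map_nth_in_tuples[OF x \<tau>]])
    qed
    then show "(k, minor A k f \<sigma>) \<in> F"
      using minor_in_clone[OF clone _ \<tau>] minors \<sigma>K by metis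
  qed
qed

section \<open>Finite relatedness in terms of minors\<close>

text \<open>The tuples \<open>t\<^sub>1, \<dots>, t\<^sub>m\<close> on which \<open>f\<close> has to be tested repeat at most \<open>k\<close> elements of \<open>R\<close>, so
  the test is one for a \<open>k\<close>-ary minor of \<open>f\<close>.\<close>

lemma preserves_if_minors_preserve:
  assumes "R \<subseteq> tuples A r" "finite R" "card R \<le> k" "1 \<le> m"
    and minors: "\<And>\<sigma>. \<sigma> \<in> tuples {..<k} m \<Longrightarrow> preserves (k, minor A k f \<sigma>) (r, R)"
  shows "preserves (m, f) (r, R)"
  unfolding preserves_def prod.case
proof
  fix ts assume "ts \<in> tuples R m"
  then obtain us \<sigma> where us: "us \<in> tuples R k" and \<sigma>: "\<sigma> \<in> tuples {..<k} m"
    and ts: "ts = map ((!) us) \<sigma>"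
    using tuple_through_index assms(2-4) by metis
  have "minor A k f \<sigma> (map (\<lambda>t. t ! i) us) = f (map (\<lambda>t. t ! i) ts)" if "i < r" for i
  proof -
    have "map (\<lambda>t. t ! i) us \<in> tuples A k"
      by (rule map_in_tuples[OF us]) (use assms(1) that in \<open>force simp: tuples_def\<close>)
    then show ?thesis by (simp only: minor_apply ts map_nth_map[OF us \<sigma>])
  qed
  then have "map (\<lambda>i. f (map (\<lambda>t. t ! i) ts)) [0..<r]
      = map (\<lambda>i. minor A k f \<sigma> (map (\<lambda>t. t ! i) us)) [0..<r]" by simp
  also have "\<dots> \<in> R" using minors[OF \<sigma>] us by (simp add: preserves_def)
  finally show "map (\<lambda>i. f (map (\<lambda>t. t ! i) ts)) [0..<r] \<in> R" .
qed

text \<open>If \<open>L\<close> lists \<open>A\<^sup>k\<close>, then the relation below consists of the value tables of the \<open>k\<close>-ary members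
  of \<open>F\<close>, and its polymorphisms are the operations that map \<open>k\<close>-ary members to \<open>k\<close>-ary members.\<close>

lemma preserves_value_tables_iff:
  assumes clone: "is_clone A F" and L: "set L = tuples A k"
  shows "preserves (m, f) (length L, (\<lambda>g. map g L) ` nary_part F k) \<longleftrightarrow>
    (\<forall>gs\<in>tuples (nary_part F k) m. (k, compose_op A k f gs) \<in> F)"
proof -
  let ?T = "\<lambda>g. map g L"
  have table: "map (\<lambda>i. f (map (\<lambda>t. t ! i) (map ?T gs))) [0..<length L] = ?T (compose_op A k f gs)"
    for gs
  proof (rule nth_equalityI)
    fix i assume "i < length (map (\<lambda>i. f (map (\<lambda>t. t ! i) (map ?T gs))) [0..<length L])"
    then have i: "i < length L" by simp
    then have "L ! i \<in> tuples A k" using L nth_mem by blast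
    then show "map (\<lambda>i. f (map (\<lambda>t. t ! i) (map ?T gs))) [0..<length L] ! i
        = ?T (compose_op A k f gs) ! i"
      using i by (simp add: compose_op_def comp_def)
  qed simp
  have mem: "?T h \<in> ?T ` nary_part F k \<longleftrightarrow> (k, h) \<in> F" if "h \<in> extensional (tuples A k)" for h
  proof
    assume "?T h \<in> ?T ` nary_part F k"
    then obtain g where g: "(k, g) \<in> F" "?T h = ?T g" by (auto simp: nary_part_def)
    have "h = g"
    proof (rule extensionalityI[OF that])
      show "g \<in> extensional (tuples A k)"
        using clone_operations[OF clone g(1)] by (simp add: PiE_def)
      show "h x = g x" if "x \<in> tuples A k" for x using g(2) that L by simp
    qed
    then show "(k, h) \<in> F" using g(1) by simp
  qed (auto simp: nary_part_def)
  have tuples_tables: "tuples (?T ` nary_part F k) m = map ?T ` tuples (nary_part F k) m"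
  proof
    show "tuples (?T ` nary_part F k) m \<subseteq> map ?T ` tuples (nary_part F k) m"
    proof
      fix ts assume ts: "ts \<in> tuples (?T ` nary_part F k) m"
      then have "ts \<in> lists (?T ` nary_part F k)" by (auto simp: tuples_def)
      then obtain gs where "gs \<in> lists (nary_part F k)" "ts = map ?T gs"
        unfolding lists_image by blast
      then show "ts \<in> map ?T ` tuples (nary_part F k) m"
        using ts by (auto simp: tuples_def)
    qed
  qed (auto intro: map_in_tuples)
  have "compose_op A k f gs \<in> extensional (tuples A k)" for gs
    by (simp add: compose_op_def)
  then show ?thesis
    unfolding preserves_def prod.case tuples_tables ball_simps table by (simp only: mem)
qed

lemma finitely_related_iff_determined_by_minors:
  assumes fin: "finite A" and clone: "is_clone A F"
  shows "finitely_related A F \<longleftrightarrow> (\<exists>k\<ge>1. determined_by_minors A F k)"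
proof
  assume "finitely_related A F"
  then obtain \<R> where \<R>: "finite \<R>" "\<R> \<subseteq> relations A" "F = Pol A \<R>"
    by (auto simp: finitely_related_def)
  define k where "k = Max (insert 1 ((\<lambda>(r, R). card R) ` \<R>))"
  have card: "card R \<le> k" if "(r, R) \<in> \<R>" for r R
    unfolding k_def using \<R>(1) that by (intro Max_ge) force+
  have "1 \<le> k" unfolding k_def using \<R>(1) by (intro Max_ge) auto
  moreover have "determined_by_minors A F k"
    unfolding determined_by_minors_def
  proof (intro allI impI)
    fix m f assume op: "(m, f) \<in> operations A"
      and minors: "\<forall>\<sigma>\<in>tuples {..<k} m. (k, minor A k f \<sigma>) \<in> F"
    have "preserves (m, f) (r, R)" if rel: "(r, R) \<in> \<R>" for r R
    proof (rule preserves_if_minors_preserve)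
      show R: "R \<subseteq> tuples A r" using rel \<R>(2) by (auto simp: relations_def)
      then show "finite R" using finite_tuples[OF fin] finite_subset by blast
      show "card R \<le> k" using card rel by blast
      show "1 \<le> m" using op by (simp add: operations_def)
      show "preserves (k, minor A k f \<sigma>) (r, R)" if "\<sigma> \<in> tuples {..<k} m" for \<sigma>
        using minors that rel \<R>(3) by (auto simp: Pol_def)
    qed
    then show "(m, f) \<in> F" using op \<R>(3) by (auto simp: Pol_def)
  qed
  ultimately show "\<exists>k\<ge>1. determined_by_minors A F k" by blast
next
  assume "\<exists>k\<ge>1. determined_by_minors A F k"
  then obtain k where det: "determined_by_minors A F k" by blast
  obtain L where L: "set L = tuples A k"
    using finite_list[OF finite_tuples[OF fin]] by blast
  define \<rho> where "\<rho> = (length L, (\<lambda>g. map g L) ` nary_part F k)"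
  have "\<rho> \<in> relations A"
  proof -
    have "map g L \<in> tuples A (length L)" if "(k, g) \<in> F" for g
      by (rule map_in_tuples[of L "tuples A k"])
        (use clone_operations[OF clone that] L in \<open>auto simp: tuples_def PiE_mem\<close>)
    then show ?thesis by (auto simp: \<rho>_def relations_def nary_part_def)
  qed
  moreover have "F = Pol A {\<rho>}"
  proof (intro equalityI subrelI)
    fix m f assume f: "(m, f) \<in> F"
    then have "preserves (m, f) \<rho>"
      unfolding \<rho>_def preserves_value_tables_iff[OF clone L] using clone_compose[OF clone] by blast
    then show "(m, f) \<in> Pol A {\<rho>}" using f clone by (auto simp: Pol_def is_clone_def)
  next
    fix m f assume f: "(m, f) \<in> Pol A {\<rho>}"
    show "(m, f) \<in> F"
    proof (rule determined_by_minorsD[OF det])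
      show "(m, f) \<in> operations A" using f by (simp add: Pol_def)
      have "\<forall>gs\<in>tuples (nary_part F k) m. (k, compose_op A k f gs) \<in> F"
        using f by (simp add: Pol_def \<rho>_def preserves_value_tables_iff[OF clone L])
      then show "(k, minor A k f \<sigma>) \<in> F" if "\<sigma> \<in> tuples {..<k} m" for \<sigma>
        unfolding minor_def using projections_in_tuples[OF clone that] by blast
    qed
  qed
  ultimately show "finitely_related A F"
    unfolding finitely_related_def by (intro exI[of _ "{\<rho>}"]) simp
qed

section \<open>Operations and their actions\<close>

lemma nary_part_PiE: "is_clone A F \<Longrightarrow> h \<in> nary_part F n \<Longrightarrow> h \<in> tuples A n \<rightarrow>\<^sub>E A"
  using clone_operations by (fastforce simp: nary_part_def)

lemma values_in_tuples:
  assumes "is_clone A F" "hs \<in> tuples (nary_part F n) k" "x \<in> tuples A n"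
  shows "map (\<lambda>h. h x) hs \<in> tuples A k"
  using map_in_tuples[OF assms(2)] nary_part_PiE[OF assms(1)] assms(3) by (metis PiE_mem)

lemma finite_nary_part:
  assumes "finite A" "is_clone A F"
  shows "finite (nary_part F n)"
proof (rule finite_subset)
  show "nary_part F n \<subseteq> tuples A n \<rightarrow>\<^sub>E A" using nary_part_PiE[OF assms(2)] by blast
  show "finite (tuples A n \<rightarrow>\<^sub>E A)" by (rule finite_PiE[OF finite_tuples[OF assms(1)] assms(1)])
qed

lemma action_op_extensional: "action_op A F n k f \<in> extensional (tuples (nary_part F n) k)"
  by (simp add: action_op_def)

lemma action_op_apply:
  assumes "hs \<in> tuples (nary_part F n) k" "x \<in> tuples A n"
  shows "action_op A F n k f hs x = f (map (\<lambda>h. h x) hs)"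
  using assms by (simp add: action_op_def compose_op_def)

lemma action_op_eq_compose_op:
  "hs \<in> tuples (nary_part F n) k \<Longrightarrow> action_op A F n k f hs = compose_op A n f hs"
  by (simp add: action_op_def)

text \<open>At a tuple that lists all of \<open>A\<close>, suitable projections take any prescribed values.\<close>

lemma action_op_inject:
  assumes clone: "is_clone A F" and A: "finite A" "A \<noteq> {}" "card A \<le> n"
    and f: "f \<in> tuples A m \<rightarrow>\<^sub>E A" and g: "g \<in> tuples A m \<rightarrow>\<^sub>E A"
    and eq: "action_op A F n m f = action_op A F n m g" and m: "1 \<le> m"
  shows "f = g"
proof (rule PiE_ext[OF f g])
  fix y assume "y \<in> tuples A m"
  then obtain a \<sigma> where a: "a \<in> tuples A n" and \<sigma>: "\<sigma> \<in> tuples {..<n} m" and y: "y = map ((!) a) \<sigma>"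
    using tuple_through_index A m by metis
  let ?ps = "map (projection A n) \<sigma>"
  have "map (\<lambda>h. h a) ?ps = y" using a by (simp add: y projection_def)
  then show "f y = g y"
    using action_op_apply[OF projections_in_tuples[OF clone \<sigma>] a] eq by metis
qed

lemma minor_action_op:
  assumes clone: "is_clone A F" and \<sigma>: "\<sigma> \<in> tuples {..<k} m"
  shows "minor (nary_part F n) k (action_op A F n m f) \<sigma> = action_op A F n k (minor A k f \<sigma>)"
proof (rule extensionalityI[OF minor_extensional action_op_extensional])
  fix hs assume hs: "hs \<in> tuples (nary_part F n) k"
  show "minor (nary_part F n) k (action_op A F n m f) \<sigma> hs = action_op A F n k (minor A k f \<sigma>) hs"
    unfolding minor_apply[OF hs] action_op_eq_compose_op[OF hs]
      action_op_eq_compose_op[OF map_nth_in_tuples[OF hs \<sigma>]]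
    unfolding compose_op_def
  proof (rule restrict_ext)
    fix x assume x: "x \<in> tuples A n"
    show "f (map (\<lambda>g. g x) (map ((!) hs) \<sigma>)) = minor A k f \<sigma> (map (\<lambda>g. g x) hs)"
      unfolding minor_apply[OF values_in_tuples[OF clone hs x]] map_nth_map[OF hs \<sigma>] ..
  qed
qed

lemma action_op_in_action_ops: "(k, f) \<in> F \<Longrightarrow> (k, action_op A F n k f) \<in> action_ops A F n"
  by (auto simp: action_ops_def)

lemma action_opsE:
  assumes "(k, G) \<in> action_ops A F n"
  obtains f where "(k, f) \<in> F" "G = action_op A F n k f"
  using assms by (auto simp: action_ops_def)

text \<open>An operation outside the clone need not map \<open>n\<close>-ary members to \<open>n\<close>-ary members, but on a given
  tuple of them it acts as one of its minors.\<close>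

lemma action_op_PiE_if_minors:
  assumes clone: "is_clone A F" and k: "finite (nary_part F n)" "card (nary_part F n) \<le> k"
    and m: "1 \<le> m" and minors: "\<And>\<sigma>. \<sigma> \<in> tuples {..<k} m \<Longrightarrow> (k, minor A k f \<sigma>) \<in> F"
  shows "action_op A F n m f \<in> tuples (nary_part F n) m \<rightarrow>\<^sub>E nary_part F n"
proof (rule PiE_I)
  fix hs assume "hs \<in> tuples (nary_part F n) m"
  then obtain us \<sigma> where us: "us \<in> tuples (nary_part F n) k" and \<sigma>: "\<sigma> \<in> tuples {..<k} m"
    and hs: "hs = map ((!) us) \<sigma>"
    using tuple_through_index k m by metis
  have "action_op A F n m f hs = action_op A F n k (minor A k f \<sigma>) us"
    by (simp only: hs flip: minor_apply[OF us] minor_action_op[OF clone \<sigma>])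
  also have "\<dots> \<in> nary_part F n"
    using clone_compose[OF clone minors[OF \<sigma>] us]
    by (simp add: action_op_eq_compose_op[OF us] nary_part_def)
  finally show "action_op A F n m f hs \<in> nary_part F n" .
qed (rule extensional_arb[OF action_op_extensional])

text \<open>In an action, the value at a point depends only on the values of the arguments at that point, and
  the two points may even differ. To compare \<open>hs\<close> with \<open>hs'\<close>, it suffices to identify variables that
  carry the same pair of entries. The pairs come from \<open>zip hs hs'\<close> and not from the full square,
  so that also the pairs which fill up a \<open>k\<close>-tuple agree at \<open>x\<close> and \<open>x'\<close>.\<close>

lemma values_determine_value_if_minors:
  assumes k: "finite (nary_part F n)" "(card (nary_part F n))\<^sup>2 \<le> k" and m: "1 \<le> m"
    and minors: "\<And>\<sigma>. \<sigma> \<in> tuples {..<k} m \<Longrightarrow>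
      (k, minor (nary_part F n) k G \<sigma>) \<in> action_ops A F n"
    and hs: "hs \<in> tuples (nary_part F n) m" and hs': "hs' \<in> tuples (nary_part F n) m"
    and x: "x \<in> tuples A n" and x': "x' \<in> tuples A n"
    and eq: "map (\<lambda>h. h x) hs = map (\<lambda>h. h x') hs'"
  shows "G hs x = G hs' x'"
proof -
  let ?U = "nary_part F n"
  let ?S = "set (zip hs hs')"
  have len: "length hs = m" "length hs' = m" using hs hs' by (auto simp: tuples_def)
  have S: "?S \<subseteq> ?U \<times> ?U"
    using hs hs' by (auto simp: tuples_def dest: set_zip_leftD set_zip_rightD)
  then have "card ?S \<le> card (?U \<times> ?U)" using k(1) by (intro card_mono) auto
  then have "card ?S \<le> k" using k(2) by (simp add: card_cartesian_product power2_eq_square)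
  moreover have "zip hs hs' \<in> tuples ?S m" using len by (simp add: tuples_def)
  ultimately obtain ps \<sigma> where ps: "ps \<in> tuples ?S k" and \<sigma>: "\<sigma> \<in> tuples {..<k} m"
    and zip: "zip hs hs' = map ((!) ps) \<sigma>"
    using tuple_through_index m by (metis finite_set)
  have fst: "map fst ps \<in> tuples ?U k" and snd: "map snd ps \<in> tuples ?U k"
    by (rule map_in_tuples[OF ps]; use S in force)+
  have hs_eq: "hs = map ((!) (map fst ps)) \<sigma>" and hs'_eq: "hs' = map ((!) (map snd ps)) \<sigma>"
    unfolding map_nth_map[OF ps \<sigma>] using len by (simp_all flip: zip)
  have "fst p x = snd p x'" if "p \<in> ?S" for p
    using that eq len by (auto simp: in_set_zip list_eq_iff_nth_eq)
  then have agree: "map (\<lambda>h. h x) (map fst ps) = map (\<lambda>h. h x') (map snd ps)"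
    using ps by (auto simp: tuples_def)
  obtain f where f: "minor ?U k G \<sigma> = action_op A F n k f"
    using minors[OF \<sigma>] by (rule action_opsE)
  have "G hs x = action_op A F n k f (map fst ps) x"
    by (simp only: hs_eq flip: f minor_apply[OF fst])
  also have "\<dots> = action_op A F n k f (map snd ps) x'"
    by (simp only: action_op_apply[OF fst x] action_op_apply[OF snd x'] agree)
  also have "\<dots> = G hs' x'" by (simp only: hs'_eq flip: f minor_apply[OF snd])
  finally show ?thesis .
qed

text \<open>The operation on \<open>A\<close> is read off by letting \<open>G\<close> act on projections and evaluating at a
  tuple \<open>a\<close> that lists all of \<open>A\<close>.\<close>

lemma action_op_of_minors:
  assumes clone: "is_clone A F" and A: "finite A" "A \<noteq> {}" "card A \<le> n"
    and k: "(card (nary_part F n))\<^sup>2 \<le> k"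
    and G: "(m, G) \<in> operations (nary_part F n)"
    and minors: "\<And>\<sigma>. \<sigma> \<in> tuples {..<k} m \<Longrightarrow>
      (k, minor (nary_part F n) k G \<sigma>) \<in> action_ops A F n"
  obtains f where "(m, f) \<in> operations A" "G = action_op A F n m f"
proof -
  let ?U = "nary_part F n"
  have m: "1 \<le> m" and GU: "G \<in> tuples ?U m \<rightarrow>\<^sub>E ?U" using G by (auto simp: operations_def)
  obtain a where a: "a \<in> tuples A n" "set a = A" using ex_enumerating_tuple[OF A] by blast
  then have "\<forall>c\<in>A. \<exists>i<n. a ! i = c" by (auto simp: tuples_def in_set_conv_nth)
  then obtain idx where idx: "\<And>c. c \<in> A \<Longrightarrow> idx c < n \<and> a ! idx c = c" by metis
  define P where "P = map (\<lambda>c. projection A n (idx c))"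
  have P: "P y \<in> tuples ?U m" if "y \<in> tuples A m" for y
    unfolding P_def using map_in_tuples[OF that] clone_projection[OF clone] idx by metis
  have P_a: "map (\<lambda>h. h a) (P y) = y" if "y \<in> tuples A m" for y
    using that idx a(1) by (auto simp: P_def tuples_def projection_def intro!: map_idI)
  define f where "f = (\<lambda>y\<in>tuples A m. G (P y) a)"
  have G_U: "G hs \<in> tuples A n \<rightarrow>\<^sub>E A" if "hs \<in> tuples ?U m" for hs
    using PiE_mem[OF GU that] nary_part_PiE[OF clone] by blast
  have "f \<in> tuples A m \<rightarrow>\<^sub>E A"
    unfolding f_def using PiE_mem[OF G_U[OF P] a(1)] by simp
  then have "(m, f) \<in> operations A" using m by (simp add: operations_def)
  moreover have "G = action_op A F n m f"
  proof (rule extensionalityI[OF _ action_op_extensional])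
    show "G \<in> extensional (tuples ?U m)" using GU by (simp add: PiE_def)
    fix hs assume hs: "hs \<in> tuples ?U m"
    have "G hs x = f (map (\<lambda>h. h x) hs)" if x: "x \<in> tuples A n" for x
    proof -
      let ?y = "map (\<lambda>h. h x) hs"
      have y: "?y \<in> tuples A m" by (rule values_in_tuples[OF clone hs x])
      have "G hs x = G (P ?y) a"
        by (rule values_determine_value_if_minors[OF finite_nary_part[OF A(1) clone] k m minors
              hs P[OF y] x a(1)]) (use P_a[OF y] in simp_all)
      then show ?thesis using y by (simp add: f_def)
    qed
    then show "G hs = action_op A F n m f hs"
      unfolding action_op_eq_compose_op[OF hs] compose_op_def
      using G_U[OF hs] by (intro extensionalityI[of _ "tuples A n"]) (auto simp: PiE_def)
  qed
  ultimately show thesis by (rule that)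
qed

section \<open>The clone and its action algebra\<close>

lemma determined_by_minors_action_ops_iff:
  assumes clone: "is_clone A F" and A: "finite A" "A \<noteq> {}" "card A \<le> n"
    and k: "1 \<le> k" "(card (nary_part F n))\<^sup>2 \<le> k"
  shows "determined_by_minors (nary_part F n) (action_ops A F n) k \<longleftrightarrow> determined_by_minors A F k"
proof
  let ?U = "nary_part F n"
  assume det: "determined_by_minors ?U (action_ops A F n) k"
  have card: "card ?U \<le> k" using k(2) by (rule power2_nat_le_imp_le)
  show "determined_by_minors A F k"
    unfolding determined_by_minors_def
  proof (intro allI impI)
    fix m f assume "(m, f) \<in> operations A"
      and minors: "\<forall>\<sigma>\<in>tuples {..<k} m. (k, minor A k f \<sigma>) \<in> F"
    then have m: "1 \<le> m" and f: "f \<in> tuples A m \<rightarrow>\<^sub>E A" by (auto simp: operations_def)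
    have "(m, action_op A F n m f) \<in> action_ops A F n"
    proof (rule determined_by_minorsD[OF det])
      show "(m, action_op A F n m f) \<in> operations ?U"
        using action_op_PiE_if_minors[OF clone finite_nary_part[OF A(1) clone] card m] minors m
        by (simp add: operations_def)
      show "(k, minor ?U k (action_op A F n m f) \<sigma>) \<in> action_ops A F n"
        if "\<sigma> \<in> tuples {..<k} m" for \<sigma>
        using minors that by (simp add: minor_action_op[OF clone that] action_op_in_action_ops)
    qed
    then obtain g where g: "(m, g) \<in> F" "action_op A F n m f = action_op A F n m g"
      by (rule action_opsE)
    then have "f = g"
      using action_op_inject[OF clone A f _ g(2) m] clone_operations[OF clone g(1)] by blast
    then show "(m, f) \<in> F" using g(1) by simp
  qed
next
  let ?U = "nary_part F n"
  assume det: "determined_by_minors A F k"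
  show "determined_by_minors ?U (action_ops A F n) k"
    unfolding determined_by_minors_def
  proof (intro allI impI)
    fix m G assume G: "(m, G) \<in> operations ?U"
      and minors: "\<forall>\<sigma>\<in>tuples {..<k} m. (k, minor ?U k G \<sigma>) \<in> action_ops A F n"
    obtain f where f: "(m, f) \<in> operations A" "G = action_op A F n m f"
      using action_op_of_minors[OF clone A k(2) G] minors by blast
    have "(m, f) \<in> F"
    proof (rule determined_by_minorsD[OF det f(1)])
      fix \<sigma> assume \<sigma>: "\<sigma> \<in> tuples {..<k} m"
      then have "(k, action_op A F n k (minor A k f \<sigma>)) \<in> action_ops A F n"
        using minors by (simp add: f(2) flip: minor_action_op[OF clone \<sigma>])
      then obtain g where g: "(k, g) \<in> F"
        "action_op A F n k (minor A k f \<sigma>) = action_op A F n k g"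
        by (rule action_opsE)
      have "minor A k f \<sigma> \<in> tuples A k \<rightarrow>\<^sub>E A"
        using minor_PiE[OF _ \<sigma>] f(1) by (auto simp: operations_def)
      then have "minor A k f \<sigma> = g"
        using action_op_inject[OF clone A _ _ g(2) k(1)] clone_operations[OF clone g(1)] by blast
      then show "(k, minor A k f \<sigma>) \<in> F" using g(1) by simp
    qed
    then show "(m, G) \<in> action_ops A F n" by (simp add: f(2) action_op_in_action_ops)
  qed
qed

theorem theorem3p11:
  fixes C :: "'a set" and \<C> :: "'a oper set" and n :: nat
  assumes "finite C" and "C \<noteq> {}"
    and "is_clone C \<C>"
    and "n \<ge> card C"
  shows "finitely_related C \<C> \<longleftrightarrow> finitely_related (nary_part \<C> n) (action_ops C \<C> n)"
proof -
  let ?U = "nary_part \<C> n" and ?D = "action_ops C \<C> n"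
  have cloneD: "is_clone ?U ?D" by (rule is_clone_action_ops[OF assms(3)])
  have transfer: "determined_by_minors ?U ?D (max k ((card ?U)\<^sup>2)) \<longleftrightarrow>
      determined_by_minors C \<C> (max k ((card ?U)\<^sup>2))" if "1 \<le> k" for k
    by (rule determined_by_minors_action_ops_iff) (use assms that in auto)
  have "(\<exists>k\<ge>1. determined_by_minors C \<C> k) \<longleftrightarrow> (\<exists>k\<ge>1. determined_by_minors ?U ?D k)"
  proof safe
    fix k :: nat assume k: "1 \<le> k"
    show "\<exists>k\<ge>1. determined_by_minors ?U ?D k" if "determined_by_minors C \<C> k"
      using determined_by_minors_mono[OF assms(3) that k max.cobounded1] transfer[OF k] k
      by (meson max.coboundedI1)
    show "\<exists>k\<ge>1. determined_by_minors C \<C> k" if "determined_by_minors ?U ?D k"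
      using determined_by_minors_mono[OF cloneD that k max.cobounded1] transfer[OF k] k
      by (meson max.coboundedI1)
  qed
  then show ?thesis
    using finitely_related_iff_determined_by_minors[OF assms(1,3)]
      finitely_related_iff_determined_by_minors[OF finite_nary_part[OF assms(1,3)] cloneD]
    by blast
qed

end
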